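(* Let $G$ be a finite graph on $n$ vertices whose admissible augmentation $C(G)$ is the complete graph $K_n$ (that is, any two distinct non-adjacent vertices of $G$ have at least $5$ common neighbors in $G$). Then $G$ satisfies the token graph reconstruction conjecture: for every integer $k$ with $1\le k<n$ and every finite graph $H$, if $F_k(G)\cong F_k(H)$, then $G\cong H$.
   Context: All graphs are finite, simple and undirected; edges are regarded as 2-element subsets of the vertex set, and $N_G(u)$ denotes the set of neighbors of $u$ in $G$. For a graph $G$ and an integer $k$ with $1\le k<|V(G)|$, the $k$-token graph $F_k(G)$ is the graph whose vertices are the $k$-element subsets of $V(G)$, with two such subsets $A,B$ adjacent if and only if their symmetric difference $A\triangle B$ is an edge of $G$ (in particular $|A\triangle B|=2$). In the claim, $H$ ranges over all finite graphs for which $F_k(H)$ is defined (i.e. $k<|V(H)|$), and is not assumed to have the same number of vertices as $G$. A pair $\{u,v\}$ of distinct vertices of $G$ is called admissible if $|N_G(u)\cap N_G(v)|\ge 5$; $A(G)$ denotes the set of all admissible pairs of $G$. The admissible augmentation of $G$ is the graph $C(G)=(V(G),E(G)\cup A(G))$. *)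

theory Defs
  imports Main
begin

record 'a graph =
  vertices :: "'a set"
  edges :: "'a set set"

definition fin_simple_graph :: "'a graph \<Rightarrow> bool" where
  "fin_simple_graph G \<longleftrightarrow>
     finite (vertices G) \<and> (\<forall>e\<in>edges G. e \<subseteq> vertices G \<and> card e = 2)"

definition complete_graph :: "'a set \<Rightarrow> 'a graph" where
  "complete_graph V = \<lparr>vertices = V, edges = {e. e \<subseteq> V \<and> card e = 2}\<rparr>"

definition neighbors :: "'a graph \<Rightarrow> 'a \<Rightarrow> 'a set" where
  "neighbors G u = {v \<in> vertices G. {u, v} \<in> edges G}"

definition graph_iso :: "'a graph \<Rightarrow> 'b graph \<Rightarrow> bool" where
  "graph_iso G H \<longleftrightarrow>
     (\<exists>f. bij_betw f (vertices G) (vertices H) \<and>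
          (\<forall>u\<in>vertices G. \<forall>v\<in>vertices G. {u, v} \<in> edges G \<longleftrightarrow> {f u, f v} \<in> edges H))"

text \<open>
  The token graph \<open>F\<^sub>k(G)\<close>. It is meant for \<open>1 \<le> k < card (vertices G)\<close>; the definition
  does not enforce this range.
\<close>
definition token_graph :: "nat \<Rightarrow> 'a graph \<Rightarrow> 'a set graph" where
  "token_graph k G =
     \<lparr>vertices = {A. A \<subseteq> vertices G \<and> card A = k},
      edges = {{A, B} | A B. A \<subseteq> vertices G \<and> card A = k \<and> B \<subseteq> vertices G \<and> card B = k \<and>
                             sym_diff A B \<in> edges G}\<rparr>"

definition admissible_pairs :: "'a graph \<Rightarrow> 'a set set" where
  "admissible_pairs G =
     {{u, v} | u v. u \<in> vertices G \<and> v \<in> vertices G \<and> u \<noteq> v \<and>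
                    card (neighbors G u \<inter> neighbors G v) \<ge> 5}"

definition admissible_augmentation :: "'a graph \<Rightarrow> 'a graph" where
  "admissible_augmentation G =
     \<lparr>vertices = vertices G, edges = edges G \<union> admissible_pairs G\<rparr>"

lemma fin_simple_graph_complete_graph:
  "finite V \<Longrightarrow> fin_simple_graph (complete_graph V)"
  by (simp add: fin_simple_graph_def complete_graph_def)

lemma fin_simple_graph_admissible_augmentation:
  "fin_simple_graph G \<Longrightarrow> fin_simple_graph (admissible_augmentation G)"
  by (auto simp: fin_simple_graph_def admissible_augmentation_def admissible_pairs_def)

lemma fin_simple_graph_token_graph:
  assumes "fin_simple_graph G"
  shows "fin_simple_graph (token_graph k G)"
proof -
  have "finite {A. A \<subseteq> vertices G \<and> card A = k}"
    using assms by (simp add: fin_simple_graph_def)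
  moreover have "A \<noteq> B" if "sym_diff A B \<in> edges G" for A B
    using that assms by (auto simp: fin_simple_graph_def)
  ultimately show ?thesis
    by (auto simp: fin_simple_graph_def token_graph_def card_insert_if)
qed

lemma admissible_augmentation_eq_complete_graph_iff:
  assumes "fin_simple_graph G"
  shows "admissible_augmentation G = complete_graph (vertices G) \<longleftrightarrow>
    (\<forall>u\<in>vertices G. \<forall>v\<in>vertices G. u \<noteq> v \<and> {u, v} \<notin> edges G \<longrightarrow>
       card (neighbors G u \<inter> neighbors G v) \<ge> 5)" (is "?L \<longleftrightarrow> ?R")
proof
  assume L: ?L
  show ?R
  proof (intro ballI impI)
    fix u v assume uv: "u \<in> vertices G" "v \<in> vertices G" "u \<noteq> v \<and> {u, v} \<notin> edges G"
    then have "{u, v} \<in> edges (complete_graph (vertices G))"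
      by (simp add: complete_graph_def)
    with L uv have "{u, v} \<in> admissible_pairs G"
      by (metis (no_types, lifting) UnE admissible_augmentation_def graph.select_convs(2))
    then show "card (neighbors G u \<inter> neighbors G v) \<ge> 5"
      by (auto simp: admissible_pairs_def doubleton_eq_iff Int_commute)
  qed
next
  assume R: ?R
  have "e \<in> edges G \<union> admissible_pairs G" if "e \<subseteq> vertices G" "card e = 2" for e
  proof -
    obtain u v where "e = {u, v}" "u \<noteq> v" using \<open>card e = 2\<close> by (auto simp: card_2_iff)
    with R that show ?thesis by (auto simp: admissible_pairs_def)
  qed
  moreover have "e \<subseteq> vertices G \<and> card e = 2" if "e \<in> edges G \<union> admissible_pairs G" for e
    using that assms by (auto simp: fin_simple_graph_def admissible_pairs_def)
  ultimately have "edges G \<union> admissible_pairs G = {e. e \<subseteq> vertices G \<and> card e = 2}"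
    by blast
  then show ?L by (simp add: admissible_augmentation_def complete_graph_def)
qed

end

theory Submission
  imports Defs
begin

text \<open>
  Call two \<open>k\<close>-sets Johnson-adjacent if their symmetric difference, the label of the pair, has
  two elements. Two \<open>k\<close>-sets with at least five common neighbours in a token graph are
  Johnson-adjacent; conversely, the hypothesis on \<open>G\<close> makes every Johnson-adjacent pair either
  adjacent or a pair with at least five common neighbours in \<open>F\<^sub>k(G)\<close>. An isomorphism
  from \<open>F\<^sub>k(G)\<close> to \<open>F\<^sub>k(H)\<close> therefore preserves Johnson adjacency, and by
  counting pairs it is an isomorphism of Johnson graphs. Opposite edges of an induced 4-cycle in a
  Johnson graph have equal labels, and all edges with a given label are connected through such
  4-cycles, so the isomorphism induces an injective map on labels. This map sends triangles to
  triangles, hence comes from a bijection of the vertices, which is an isomorphism from \<open>G\<close>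
  to \<open>H\<close>. Working with labels avoids a separate treatment of complementation in the case
  \<open>n = 2 k\<close>.
\<close>

section \<open>Finite \<open>k\<close>-subsets and their symmetric differences\<close>

definition k_subsets :: "nat \<Rightarrow> 'a set \<Rightarrow> 'a set set" where
  "k_subsets k V = {A. A \<subseteq> V \<and> card A = k}"

lemma finite_k_subsets: "finite V \<Longrightarrow> finite (k_subsets k V)"
  by (simp add: k_subsets_def)

lemma finite_member_k_subsets: "finite V \<Longrightarrow> A \<in> k_subsets k V \<Longrightarrow> finite A"
  by (auto simp: k_subsets_def intro: finite_subset)

text \<open>The additive form avoids truncated subtraction and shows that the symmetric difference
  has the parity of \<open>card A + card B\<close>.\<close>

lemma card_sym_diff:
  assumes "finite A" "finite B"
  shows "card (sym_diff A B) + 2 * card (A \<inter> B) = card A + card B"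
proof -
  have "card (sym_diff A B) = card (A - B) + card (B - A)"
    using assms by (intro card_Un_disjoint) auto
  moreover have "card A = card (A - B) + card (A \<inter> B)"
    using assms card_Diff_subset_Int[of A B] card_mono[of A "A \<inter> B"] by simp
  moreover have "card B = card (B - A) + card (A \<inter> B)"
    using assms card_Diff_subset_Int[of B A] card_mono[of B "A \<inter> B"] by (simp add: Int_commute)
  ultimately show ?thesis by simp
qed

text \<open>The symmetric difference of two 2-sets has 0, 2 or 4 elements. With 0 and 2 excluded it
  has 4, which leaves nothing for the intersection.\<close>

lemma disjoint_if_card_sym_diff:
  assumes "card P = 2" "card Q = 2" "P \<noteq> Q" "card (sym_diff P Q) \<noteq> 2"
  shows "P \<inter> Q = {}"
proof -
  have fin: "finite P" "finite Q" using assms by (auto intro: card_ge_0_finite)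
  have "card (sym_diff P Q) + 2 * card (P \<inter> Q) = 4"
    using card_sym_diff[OF fin] assms by simp
  moreover have "card (sym_diff P Q) \<noteq> 0"
    using assms(3) fin by auto
  ultimately have "card (P \<inter> Q) = 0" using assms(4) by presburger
  then show ?thesis using fin by simp
qed

lemma card_2_inter_eq_1:
  assumes "card P = 2" "card Q = 2" "card (sym_diff P Q) = 2"
  obtains c where "P \<inter> Q = {c}"
proof -
  have fin: "finite P" "finite Q" using assms by (auto intro: card_ge_0_finite)
  have "card (P \<inter> Q) = 1"
    using card_sym_diff[OF fin] assms by simp
  then show ?thesis using that by (auto simp: card_1_singleton_iff)
qed

text \<open>Since the two sets have equal size, the label contributes one element to each side;
  \<open>S\<close> is the common part \<open>A \<inter> B\<close>.\<close>

lemma k_subsets_sym_diff_eq_2E: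
  assumes V: "finite V" and A: "A \<in> k_subsets k V" and B: "B \<in> k_subsets k V"
    and AB: "card (sym_diff A B) = 2"
  obtains S u v where "A = insert u S" "B = insert v S" "u \<notin> S" "v \<notin> S" "u \<noteq> v"
    "S \<subseteq> V" "u \<in> V" "v \<in> V" "sym_diff A B = {u, v}" "k = Suc (card S)"
proof -
  have fin: "finite A" "finite B" using assms finite_member_k_subsets by blast+
  have c: "card A = k" "card B = k" using A B by (auto simp: k_subsets_def)
  have "card (A \<inter> B) = k - 1" "k \<ge> 1"
    using card_sym_diff[OF fin] c AB by simp_all
  then have "card (A - B) = 1" "card (B - A) = 1"
    using fin c by (simp_all add: card_Diff_subset_Int Int_commute)
  then obtain u v where uv: "A - B = {u}" "B - A = {v}"
    by (auto simp: card_1_singleton_iff)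
  show ?thesis
  proof (rule that[of u "A \<inter> B" v])
    show "k = Suc (card (A \<inter> B))" using \<open>card (A \<inter> B) = k - 1\<close> \<open>k \<ge> 1\<close> by simp
  qed (use uv A B in \<open>auto simp: k_subsets_def\<close>)
qed

lemma insert_in_k_subsets:
  assumes "finite V" "S \<subseteq> V" "u \<in> V" "u \<notin> S" "k = Suc (card S)"
  shows "insert u S \<in> k_subsets k V"
  using assms finite_subset[of S V] by (auto simp: k_subsets_def)

section \<open>Isomorphisms of Johnson graphs\<close>

locale johnson_iso =
  fixes V :: "'a set" and W :: "'b set" and k :: nat and \<phi> :: "'a set \<Rightarrow> 'b set"
  assumes finite_V: "finite V" and finite_W: "finite W"
    and bij: "bij_betw \<phi> (k_subsets k V) (k_subsets k W)"
    and adj_iff: "\<And>A B. A \<in> k_subsets k V \<Longrightarrow> B \<in> k_subsets k V \<Longrightarrow>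
      card (sym_diff (\<phi> A) (\<phi> B)) = 2 \<longleftrightarrow> card (sym_diff A B) = 2"
begin

text \<open>Lets \<open>equal_labels\<close> be applied backwards, which turns well-definedness of
  the label map into its injectivity.\<close>

lemma inverse: "johnson_iso W V k (inv_into (k_subsets k V) \<phi>)"
proof
  let ?\<psi> = "inv_into (k_subsets k V) \<phi>"
  show bij': "bij_betw ?\<psi> (k_subsets k W) (k_subsets k V)"
    by (rule bij_betw_inv_into[OF bij])
  fix A B assume AB: "A \<in> k_subsets k W" "B \<in> k_subsets k W"
  then have "?\<psi> A \<in> k_subsets k V" "?\<psi> B \<in> k_subsets k V"
    using bij' by (auto dest: bij_betwE)
  from adj_iff[OF this] show "card (sym_diff (?\<psi> A) (?\<psi> B)) = 2 \<longleftrightarrow> card (sym_diff A B) = 2"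
    using AB bij by (simp add: bij_betw_inv_into_right)
qed (rule finite_W finite_V)+

lemma map_in: "A \<in> k_subsets k V \<Longrightarrow> \<phi> A \<in> k_subsets k W"
  using bij by (auto dest: bij_betwE)

lemma map_eq_iff:
  "A \<in> k_subsets k V \<Longrightarrow> B \<in> k_subsets k V \<Longrightarrow> \<phi> A = \<phi> B \<longleftrightarrow> A = B"
  using bij by (auto simp: bij_betw_def inj_on_eq_iff)

text \<open>
  In an induced 4-cycle \<open>A, B, D, C\<close> the labels of consecutive edges are disjoint 2-sets,
  and \<open>sym_diff A D\<close> is partitioned by the labels along both of the paths from \<open>A\<close> to \<open>D\<close>.
  This forces opposite edges to carry the same label.
\<close>
lemma induced_4_cycle_opposite_labels:
  assumes "A \<in> k_subsets k V" "B \<in> k_subsets k V" "C \<in> k_subsets k V" "D \<in> k_subsets k V"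
    and cyc: "card (sym_diff A B) = 2" "card (sym_diff B D) = 2"
      "card (sym_diff A C) = 2" "card (sym_diff C D) = 2"
    and ind: "A \<noteq> D" "card (sym_diff A D) \<noteq> 2" "B \<noteq> C" "card (sym_diff B C) \<noteq> 2"
  shows "sym_diff (\<phi> A) (\<phi> B) = sym_diff (\<phi> C) (\<phi> D)"
proof -
  let ?P = "sym_diff (\<phi> A) (\<phi> B)" and ?Q = "sym_diff (\<phi> B) (\<phi> D)"
  let ?R = "sym_diff (\<phi> A) (\<phi> C)" and ?T = "sym_diff (\<phi> C) (\<phi> D)"
  have c: "card ?P = 2" "card ?Q = 2" "card ?R = 2" "card ?T = 2"
    using assms adj_iff by simp_all
  have AD: "\<phi> A \<noteq> \<phi> D" "card (sym_diff (\<phi> A) (\<phi> D)) \<noteq> 2" and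
    BC: "\<phi> B \<noteq> \<phi> C" "card (sym_diff (\<phi> B) (\<phi> C)) \<noteq> 2"
    using assms adj_iff map_eq_iff by simp_all
  have PQ: "sym_diff ?P ?Q = sym_diff (\<phi> A) (\<phi> D)" by blast
  have RT: "sym_diff ?R ?T = sym_diff (\<phi> A) (\<phi> D)" by blast
  have PR: "sym_diff ?P ?R = sym_diff (\<phi> B) (\<phi> C)" by blast
  have "?P \<inter> ?Q = {}"
    by (rule disjoint_if_card_sym_diff) (use c AD PQ in \<open>auto simp del: Un_iff\<close>)
  moreover have "?P \<inter> ?R = {}"
    by (rule disjoint_if_card_sym_diff) (use c BC PR in \<open>auto simp del: Un_iff\<close>)
  \<comment> \<open>A point of \<open>?P\<close> is outside \<open>?Q\<close>, hence in
    \<open>sym_diff (\<phi> A) (\<phi> D)\<close>, hence in exactly one of \<open>?R\<close> and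
    \<open>?T\<close>; it is not in \<open>?R\<close>.\<close>
  ultimately have "?P \<subseteq> ?T" by blast
  then show ?thesis
    using c by (intro card_subset_eq) (simp_all add: card_ge_0_finite del: finite_Un)
qed

text \<open>Exchanging an element of \<open>S - S'\<close> for one of \<open>S' - S\<close> brings
  the base closer to \<open>S'\<close>. Each exchange spans an induced 4-cycle in which the edges
  with label \<open>{u, v}\<close> are opposite.\<close>

lemma label_independent_of_base:
  assumes uv: "u \<in> V" "v \<in> V" "u \<noteq> v"
    and "S \<subseteq> V - {u, v}" "S' \<subseteq> V - {u, v}" "k = Suc (card S)" "k = Suc (card S')"
  shows "sym_diff (\<phi> (insert u S)) (\<phi> (insert v S)) =
    sym_diff (\<phi> (insert u S')) (\<phi> (insert v S'))"
  using assms(4-)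
proof (induction "card (S - S')" arbitrary: S)
  case 0
  have fin: "finite S" "finite S'" using 0 finite_V by (auto intro: finite_subset)
  with 0 have "S \<subseteq> S'" by auto
  then have "S = S'" using 0 fin by (simp add: card_subset_eq)
  then show ?case by simp
next
  case (Suc m)
  have fin: "finite S" "finite S'" using Suc.prems finite_V by (auto intro: finite_subset)
  obtain x where x: "x \<in> S" "x \<notin> S'"
    using Suc.hyps(2) by (metis Diff_iff card.empty ex_in_conv nat.distinct(1))
  have "\<not> S' \<subseteq> S"
    using Suc.prems fin x by (metis card_subset_eq Suc_inject)
  then obtain y where y: "y \<in> S'" "y \<notin> S" by blast
  define S1 where "S1 = insert y (S - {x})"
  have S1: "S1 \<subseteq> V - {u, v}" "k = Suc (card S1)"
    using Suc.prems x y fin card_Suc_Diff1[OF fin(1) x(1)] by (auto simp: S1_def)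
  have "S1 - S' = (S - S') - {x}" using y by (auto simp: S1_def)
  then have "card (S1 - S') = m" using Suc.hyps(2) x fin by simp
  then have IH: "sym_diff (\<phi> (insert u S1)) (\<phi> (insert v S1)) =
    sym_diff (\<phi> (insert u S')) (\<phi> (insert v S'))"
    using Suc.hyps(1) S1 Suc.prems by blast
  have ne: "u \<notin> S" "v \<notin> S" "y \<noteq> u" "y \<noteq> v" "x \<noteq> u" "x \<noteq> v" "x \<noteq> y"
    using Suc.prems x y by auto
  \<comment> \<open>The last two labels belong to the diagonals; having four elements, they show
    that the 4-cycle is induced.\<close>
  have d: "sym_diff (insert u S) (insert v S) = {u, v}"
    "sym_diff (insert v S) (insert v S1) = {x, y}"
    "sym_diff (insert u S) (insert u S1) = {x, y}"
    "sym_diff (insert u S1) (insert v S1) = {u, v}"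
    "sym_diff (insert u S) (insert v S1) = {u, v, x, y}"
    "sym_diff (insert v S) (insert u S1) = {u, v, x, y}"
    using ne uv(3) x y by (auto simp: S1_def)
  have mem: "insert u S \<in> k_subsets k V" "insert v S \<in> k_subsets k V"
    "insert u S1 \<in> k_subsets k V" "insert v S1 \<in> k_subsets k V"
    by (rule insert_in_k_subsets; use finite_V uv S1 Suc.prems in blast)+
  have "sym_diff (\<phi> (insert u S)) (\<phi> (insert v S)) =
    sym_diff (\<phi> (insert u S1)) (\<phi> (insert v S1))"
  proof (rule induced_4_cycle_opposite_labels)
    show "insert u S \<noteq> insert v S1" "insert v S \<noteq> insert u S1"
      using d(5,6) by blast+
  qed (unfold d, use uv(3) ne in simp_all, insert mem, assumption+)
  then show ?case using IH by simp
qed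

text \<open>A label determines the exchanged elements only up to order. As \<open>sym_diff\<close>
  is symmetric, independence of the base is enough.\<close>

lemma equal_labels:
  assumes K: "A \<in> k_subsets k V" "B \<in> k_subsets k V" "A' \<in> k_subsets k V" "B' \<in> k_subsets k V"
    and "card (sym_diff A B) = 2" "sym_diff A B = sym_diff A' B'"
  shows "sym_diff (\<phi> A) (\<phi> B) = sym_diff (\<phi> A') (\<phi> B')"
proof -
  obtain S u v where S: "A = insert u S" "B = insert v S" "u \<notin> S" "v \<notin> S" "u \<noteq> v"
    "S \<subseteq> V" "u \<in> V" "v \<in> V" "sym_diff A B = {u, v}" "k = Suc (card S)"
    using k_subsets_sym_diff_eq_2E[OF finite_V K(1,2) assms(5)] by blast
  have "card (sym_diff A' B') = 2" using assms by simp
  then obtain S' u' v' where S': "A' = insert u' S'" "B' = insert v' S'" "u' \<notin> S'" "v' \<notin> S'"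
    "S' \<subseteq> V" "sym_diff A' B' = {u', v'}" "k = Suc (card S')"
    using k_subsets_sym_diff_eq_2E[OF finite_V K(3,4)] by metis
  have uv': "{u, v} = {u', v'}" using S S' assms by simp
  then have "sym_diff (\<phi> (insert u S)) (\<phi> (insert v S)) =
    sym_diff (\<phi> (insert u S')) (\<phi> (insert v S'))"
    using S S' by (intro label_independent_of_base) (auto simp: doubleton_eq_iff)
  then show ?thesis using uv' S S' by (auto simp: doubleton_eq_iff)
qed

end

text \<open>
  A map on 2-sets that sends triangles to triangles comes from a map on points: the images of
  the pairs through a point meet pairwise and, by injectivity, contain no triangle.
\<close>
lemma triangle_preserving_map_on_pairs:
  fixes V :: "'a set" and g :: "'a set \<Rightarrow> 'b set"
  assumes three: "card V \<ge> 3"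
    and card_g: "\<And>u v. u \<in> V \<Longrightarrow> v \<in> V \<Longrightarrow> u \<noteq> v \<Longrightarrow> card (g {u, v}) = 2"
    and tri: "\<And>u v w. u \<in> V \<Longrightarrow> v \<in> V \<Longrightarrow> w \<in> V \<Longrightarrow> u \<noteq> v \<Longrightarrow> v \<noteq> w \<Longrightarrow> u \<noteq> w \<Longrightarrow>
      g {u, w} = sym_diff (g {u, v}) (g {v, w})"
    and inj: "\<And>u v w z. u \<in> V \<Longrightarrow> v \<in> V \<Longrightarrow> w \<in> V \<Longrightarrow> z \<in> V \<Longrightarrow> u \<noteq> v \<Longrightarrow> w \<noteq> z \<Longrightarrow>
      g {u, v} = g {w, z} \<Longrightarrow> {u, v} = {w, z}"
  obtains f where "inj_on f V"
    "\<And>u v. u \<in> V \<Longrightarrow> v \<in> V \<Longrightarrow> u \<noteq> v \<Longrightarrow> g {u, v} = {f u, f v}"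
proof -
  have other: "\<exists>w\<in>V. w \<noteq> u \<and> w \<noteq> v" for u v
  proof (rule ccontr)
    assume "\<not> ?thesis"
    then have "V \<subseteq> {u, v}" by blast
    then have "card V \<le> card {u, v}" by (intro card_mono) auto
    also have "\<dots> \<le> 2" by (simp add: card_insert_if)
    finally show False using three by simp
  qed
  have common: "\<exists>c. \<forall>v\<in>V. v \<noteq> u \<longrightarrow> c \<in> g {u, v}" if u: "u \<in> V" for u
  proof -
    obtain x where x: "x \<in> V" "x \<noteq> u" using other by blast
    obtain y where y: "y \<in> V" "y \<noteq> u" "y \<noteq> x" using other by blast
    \<comment> \<open>The third side \<open>g {p, q}\<close> is the symmetric difference of these
      two and has size 2, so they share exactly one point.\<close>
    have meet: "\<exists>c. g {u, p} \<inter> g {u, q} = {c}"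
      if "p \<in> V" "q \<in> V" "p \<noteq> u" "q \<noteq> u" "p \<noteq> q" for p q
    proof -
      have "g {p, q} = sym_diff (g {u, p}) (g {u, q})"
        using tri[of p u q] that u by (simp add: insert_commute)
      then show ?thesis
        using card_2_inter_eq_1[of "g {u, p}" "g {u, q}"] card_g[of u p] card_g[of u q]
          card_g[of p q] that u by metis
    qed
    obtain c where c: "g {u, x} \<inter> g {u, y} = {c}" using meet x y by blast
    have "c \<in> g {u, z}" if z: "z \<in> V" "z \<noteq> u" for z
    proof (rule ccontr)
      \<comment> \<open>If \<open>c\<close> is missed, the images of the pairs \<open>u x\<close>,
        \<open>u y\<close>, \<open>u z\<close> are the three sides of a triangle on
        \<open>a\<close>, \<open>b\<close>, \<open>c\<close>. Then \<open>g {x, y}\<close> equals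
        \<open>g {u, z}\<close>, against injectivity.\<close>
      assume nc: "c \<notin> g {u, z}"
      then have zxy: "z \<noteq> x" "z \<noteq> y" using c by auto
      obtain a where a: "g {u, x} \<inter> g {u, z} = {a}" using meet x z zxy by metis
      obtain b where b: "g {u, y} \<inter> g {u, z} = {b}" using meet y z zxy by metis
      have ne: "a \<noteq> c" "b \<noteq> c" "a \<noteq> b" using a b c nc by auto
      have eqI: "P = {p, q}" if "card P = 2" "p \<in> P" "q \<in> P" "p \<noteq> q" for P and p q :: 'b
        using that by (auto simp: card_2_iff)
      have "g {u, x} = {a, c}" "g {u, y} = {b, c}" "g {u, z} = {a, b}"
        by (rule eqI; use a b c ne card_g[of u] u x y z in blast)+
      moreover have "g {x, y} = sym_diff (g {u, x}) (g {u, y})"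
        using tri[of x u y] x y u by (simp add: insert_commute)
      ultimately have "g {x, y} = g {u, z}" using ne by auto
      then have "{x, y} = {u, z}" using inj x y z u by blast
      then show False using x y by auto
    qed
    then show ?thesis by blast
  qed
  then obtain f where f: "\<And>u v. u \<in> V \<Longrightarrow> v \<in> V \<Longrightarrow> v \<noteq> u \<Longrightarrow> f u \<in> g {u, v}"
    by metis
  \<comment> \<open>A common value would lie on all three sides of a triangle, but each side is the
    symmetric difference of the other two.\<close>
  have f_ne: "f u \<noteq> f v" if uv: "u \<in> V" "v \<in> V" "u \<noteq> v" for u v
  proof
    assume eq: "f u = f v"
    obtain w where w: "w \<in> V" "w \<noteq> u" "w \<noteq> v" using other by blast
    have "g {u, v} = sym_diff (g {u, w}) (g {w, v})" using tri[of u w v] uv w by blast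
    moreover have "f u \<in> g {u, v}" "f u \<in> g {u, w}" "f u \<in> g {w, v}"
      using f[of u v] f[of u w] f[of v w] uv w eq by (auto simp: insert_commute)
    ultimately show False by blast
  qed
  show ?thesis
  proof (rule that)
    show "inj_on f V" using f_ne by (auto simp: inj_on_def)
    fix u v assume uv: "u \<in> V" "v \<in> V" "u \<noteq> v"
    then have "f u \<in> g {u, v}" "f v \<in> g {u, v}" using f[of u v] f[of v u]
      by (auto simp: insert_commute)
    then show "g {u, v} = {f u, f v}"
      using card_g[OF uv] f_ne[OF uv] by (auto simp: card_2_iff)
  qed
qed

section \<open>Realising labels by \<open>k\<close>-sets and recovering the map on points\<close>

lemma k_subsets_pair_realised:
  assumes "finite V" "u \<in> V" "v \<in> V" "u \<noteq> v" "1 \<le> k" "k < card V"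
  obtains A B where "A \<in> k_subsets k V" "B \<in> k_subsets k V" "sym_diff A B = {u, v}"
proof -
  have "k - 1 \<le> card (V - {u, v})" using assms by (simp add: card_Diff_subset)
  then obtain S where S: "S \<subseteq> V - {u, v}" "card S = k - 1"
    by (meson obtain_subset_with_card_n)
  show ?thesis
    by (rule that[of "insert u S" "insert v S"])
      (use S assms in \<open>auto intro!: insert_in_k_subsets\<close>)
qed

text \<open>For \<open>k \<ge> 2\<close> the three sets each omit one of \<open>u\<close>,
  \<open>v\<close>, \<open>w\<close> over a base of size \<open>k - 2\<close>. Adding single points
  to a base of size \<open>k - 1\<close> would fail for \<open>k = card V - 1\<close>.\<close>

lemma k_subsets_triangle_realised:
  assumes "finite V" "u \<in> V" "v \<in> V" "w \<in> V" "u \<noteq> v" "v \<noteq> w" "u \<noteq> w" "1 \<le> k" "k < card V"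
  obtains A B C where "A \<in> k_subsets k V" "B \<in> k_subsets k V" "C \<in> k_subsets k V"
    "sym_diff A B = {u, v}" "sym_diff B C = {v, w}" "sym_diff A C = {u, w}"
proof (cases "k = 1")
  case True
  show ?thesis
    by (rule that[of "{u}" "{v}" "{w}"]) (use True assms in \<open>auto simp: k_subsets_def\<close>)
next
  case False
  then have "k - 2 \<le> card (V - {u, v, w})" using assms by (simp add: card_Diff_subset)
  then obtain S where S: "S \<subseteq> V - {u, v, w}" "card S = k - 2"
    by (meson obtain_subset_with_card_n)
  moreover have "finite S" using S assms(1) by (auto intro: finite_subset)
  ultimately show ?thesis
    by (intro that[of "insert v (insert w S)" "insert u (insert w S)" "insert u (insert v S)"])
      (use False assms in \<open>auto simp: k_subsets_def subset_iff card_insert_if\<close>)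
qed

context johnson_iso
begin

lemma point_map:
  assumes k: "1 \<le> k" "k < card V" and cVW: "card V = card W"
  obtains f where "bij_betw f V W"
    "\<And>A B u v. A \<in> k_subsets k V \<Longrightarrow> B \<in> k_subsets k V \<Longrightarrow> u \<noteq> v \<Longrightarrow>
      sym_diff A B = {u, v} \<Longrightarrow> sym_diff (\<phi> A) (\<phi> B) = {f u, f v}"
proof -
  interpret inv: johnson_iso W V k "inv_into (k_subsets k V) \<phi>" by (rule inverse)
  \<comment> \<open>The induced map on labels. The description is unique on realised labels by
    \<open>equal_labels\<close>; by \<open>k_subsets_pair_realised\<close> these include all pairs
    in \<open>V\<close>.\<close>
  define g where "g e = (THE p. \<exists>A\<in>k_subsets k V. \<exists>B\<in>k_subsets k V.
    sym_diff A B = e \<and> p = sym_diff (\<phi> A) (\<phi> B))" for e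
  have g: "g (sym_diff A B) = sym_diff (\<phi> A) (\<phi> B)"
    if AB: "A \<in> k_subsets k V" "B \<in> k_subsets k V" "card (sym_diff A B) = 2" for A B
    unfolding g_def
  proof (rule the_equality)
    show "\<exists>A'\<in>k_subsets k V. \<exists>B'\<in>k_subsets k V. sym_diff A' B' = sym_diff A B \<and>
      sym_diff (\<phi> A) (\<phi> B) = sym_diff (\<phi> A') (\<phi> B')" using AB by blast
    fix p assume "\<exists>A'\<in>k_subsets k V. \<exists>B'\<in>k_subsets k V. sym_diff A' B' = sym_diff A B \<and>
      p = sym_diff (\<phi> A') (\<phi> B')"
    then obtain A' B' where A'B': "A' \<in> k_subsets k V" "B' \<in> k_subsets k V"
      "sym_diff A' B' = sym_diff A B" "p = sym_diff (\<phi> A') (\<phi> B')" by blast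
    show "p = sym_diff (\<phi> A) (\<phi> B)"
      unfolding A'B'(4)
      by (rule equal_labels[OF A'B'(1,2) AB(1,2) _ A'B'(3)]) (use A'B'(3) AB(3) in simp)
  qed
  have realise: "\<exists>A\<in>k_subsets k V. \<exists>B\<in>k_subsets k V. sym_diff A B = {u, v} \<and>
    g {u, v} = sym_diff (\<phi> A) (\<phi> B)" if uv: "u \<in> V" "v \<in> V" "u \<noteq> v" for u v
  proof -
    obtain A B where AB: "A \<in> k_subsets k V" "B \<in> k_subsets k V" "sym_diff A B = {u, v}"
      using k_subsets_pair_realised[OF finite_V uv k] by metis
    then have "g {u, v} = sym_diff (\<phi> A) (\<phi> B)" using g[of A B] uv by simp
    then show ?thesis using AB by blast
  qed
  have card_g: "card (g {u, v}) = 2" and g_sub: "g {u, v} \<subseteq> W"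
    if uv: "u \<in> V" "v \<in> V" "u \<noteq> v" for u v
  proof -
    obtain A B where AB: "A \<in> k_subsets k V" "B \<in> k_subsets k V" "sym_diff A B = {u, v}"
      "g {u, v} = sym_diff (\<phi> A) (\<phi> B)" using realise[OF uv] by blast
    then show "card (g {u, v}) = 2" using adj_iff[of A B] uv by simp
    show "g {u, v} \<subseteq> W" using AB map_in[of A] map_in[of B] by (auto simp: k_subsets_def)
  qed
  have g_inj: "{u, v} = {w, z}"
    if uv: "u \<in> V" "v \<in> V" "w \<in> V" "z \<in> V" "u \<noteq> v" "w \<noteq> z" and eq: "g {u, v} = g {w, z}"
    for u v w z
  proof -
    obtain A B where AB: "A \<in> k_subsets k V" "B \<in> k_subsets k V" "sym_diff A B = {u, v}"
      "g {u, v} = sym_diff (\<phi> A) (\<phi> B)" using realise[of u v] uv by blast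
    obtain C D where CD: "C \<in> k_subsets k V" "D \<in> k_subsets k V" "sym_diff C D = {w, z}"
      "g {w, z} = sym_diff (\<phi> C) (\<phi> D)" using realise[of w z] uv by blast
    \<comment> \<open>Equal image labels come from equal labels: this is \<open>equal_labels\<close>
      for the inverse isomorphism.\<close>
    have "card (sym_diff (\<phi> A) (\<phi> B)) = 2" using card_g[of u v] uv AB by simp
    from inv.equal_labels[OF _ _ _ _ this, of "\<phi> C" "\<phi> D"] show ?thesis
      using AB CD eq map_in bij by (simp add: bij_betw_inv_into_left)
  qed
  have "\<exists>f. bij_betw f V W \<and> (\<forall>u\<in>V. \<forall>v\<in>V. u \<noteq> v \<longrightarrow> g {u, v} = {f u, f v})"
  proof (cases "card V \<ge> 3")
    case False
    \<comment> \<open>Here \<open>V\<close> and \<open>W\<close> each consist of a single pair, so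
      any bijection induces \<open>g\<close>.\<close>
    then have c2: "card W = 2" using k cVW by linarith
    obtain f where f: "bij_betw f V W"
      using finite_same_card_bij[OF finite_V finite_W cVW] by blast
    have "g {u, v} = {f u, f v}" if uv: "u \<in> V" "v \<in> V" "u \<noteq> v" for u v
    proof -
      have "g {u, v} = W"
        using card_g[OF uv] g_sub[OF uv] c2 finite_W by (simp add: card_subset_eq)
      moreover have "f u \<noteq> f v" "f u \<in> W" "f v \<in> W"
        using f uv by (auto simp: bij_betw_def inj_on_def)
      ultimately show ?thesis using c2 by (auto simp: card_2_iff)
    qed
    then show ?thesis using f by blast
  next
    case True
    have tri: "g {u, w} = sym_diff (g {u, v}) (g {v, w})"
      if uvw: "u \<in> V" "v \<in> V" "w \<in> V" "u \<noteq> v" "v \<noteq> w" "u \<noteq> w" for u v w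
    proof -
      obtain A B C where ABC: "A \<in> k_subsets k V" "B \<in> k_subsets k V" "C \<in> k_subsets k V"
        "sym_diff A B = {u, v}" "sym_diff B C = {v, w}" "sym_diff A C = {u, w}"
        using k_subsets_triangle_realised[OF finite_V uvw k] by metis
      then have "g {u, w} = sym_diff (\<phi> A) (\<phi> C)" "g {u, v} = sym_diff (\<phi> A) (\<phi> B)"
        "g {v, w} = sym_diff (\<phi> B) (\<phi> C)"
        using g[of A C] g[of A B] g[of B C] uvw by simp_all
      then show ?thesis by blast
    qed
    obtain f where f: "inj_on f V"
      "\<And>u v. u \<in> V \<Longrightarrow> v \<in> V \<Longrightarrow> u \<noteq> v \<Longrightarrow> g {u, v} = {f u, f v}"
      using triangle_preserving_map_on_pairs[of V g, OF True card_g tri g_inj] by blast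
    have "f u \<in> W" if u: "u \<in> V" for u
    proof -
      have "V \<noteq> {u}" using True by auto
      then obtain v where "v \<in> V" "v \<noteq> u" using u by blast
      then show ?thesis using f(2)[of u v] g_sub[of u v] u by auto
    qed
    then have "f ` V \<subseteq> W" by blast
    then have "f ` V = W"
      using f(1) cVW finite_W by (simp add: card_image card_subset_eq)
    then show ?thesis using f by (auto simp: bij_betw_def)
  qed
  then obtain f where f: "bij_betw f V W"
    "\<And>u v. u \<in> V \<Longrightarrow> v \<in> V \<Longrightarrow> u \<noteq> v \<Longrightarrow> g {u, v} = {f u, f v}" by blast
  show ?thesis
  proof (rule that[OF f(1)])
    fix A B u v assume AB: "A \<in> k_subsets k V" "B \<in> k_subsets k V" "u \<noteq> v"
      "sym_diff A B = {u, v}"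
    then have "u \<in> V" "v \<in> V" by (auto simp: k_subsets_def)
    then show "sym_diff (\<phi> A) (\<phi> B) = {f u, f v}"
      using f(2)[of u v] g[of A B] AB by simp
  qed
qed

end

section \<open>Johnson adjacency inside token graphs\<close>

lemma vertices_token_graph: "vertices (token_graph k G) = k_subsets k (vertices G)"
  by (simp add: token_graph_def k_subsets_def)

lemma edges_token_graph_iff:
  assumes "A \<in> k_subsets k (vertices G)" "B \<in> k_subsets k (vertices G)"
  shows "{A, B} \<in> edges (token_graph k G) \<longleftrightarrow> sym_diff A B \<in> edges G"
  using assms by (auto simp: token_graph_def k_subsets_def doubleton_eq_iff Un_commute)

lemma neighbors_token_graph:
  assumes "A \<in> k_subsets k (vertices G)"
  shows "neighbors (token_graph k G) A =
    {C \<in> k_subsets k (vertices G). sym_diff A C \<in> edges G}"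
  using assms by (auto simp: neighbors_def vertices_token_graph edges_token_graph_iff)

text \<open>
  Every common neighbour \<open>w\<close> of \<open>u\<close> and \<open>v\<close> yields one of \<open>S + u\<close> and \<open>S + v\<close>:
  \<open>S + w\<close> if \<open>w \<notin> S\<close>, and \<open>S - w + u + v\<close> if \<open>w \<in> S\<close>.
\<close>
lemma card_common_neighbors_token_graph_ge:
  assumes G: "fin_simple_graph G"
    and S: "S \<subseteq> vertices G" "u \<in> vertices G" "v \<in> vertices G" "u \<notin> S" "v \<notin> S" "u \<noteq> v"
      "k = Suc (card S)"
  shows "card (neighbors G u \<inter> neighbors G v) \<le>
    card (neighbors (token_graph k G) (insert u S) \<inter> neighbors (token_graph k G) (insert v S))"
proof -
  have fin: "finite (vertices G)" and e2: "\<And>e. e \<in> edges G \<Longrightarrow> card e = 2"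
    using G by (auto simp: fin_simple_graph_def)
  have finS: "finite S" using S(1) fin by (rule finite_subset)
  have mem: "insert u S \<in> k_subsets k (vertices G)" "insert v S \<in> k_subsets k (vertices G)"
    using S fin by (auto intro: insert_in_k_subsets)
  define h where "h w = (if w \<in> S then insert u (insert v (S - {w})) else insert w S)" for w
  let ?N = "neighbors G u \<inter> neighbors G v"
  have N: "w \<in> vertices G" "w \<noteq> u" "w \<noteq> v" "{u, w} \<in> edges G" "{v, w} \<in> edges G"
    if "w \<in> ?N" for w
    using that e2[of "{u, w}"] e2[of "{v, w}"] by (auto simp: neighbors_def)
  \<comment> \<open>The branches of \<open>h\<close> have disjoint ranges: as
    \<open>w \<noteq> u\<close> and \<open>u \<notin> S\<close>, the set \<open>h w\<close> contains
    \<open>u\<close> exactly if \<open>w \<in> S\<close>.\<close>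
  have "inj_on h ?N"
  proof (rule inj_onI)
    fix w z assume wz: "w \<in> ?N" "z \<in> ?N" "h w = h z"
    show "w = z"
      using wz(3) N(2,3)[OF wz(1)] N(2,3)[OF wz(2)] S(4-6)
      by (auto simp: h_def set_eq_iff split: if_splits)
  qed
  moreover have "h w \<in> neighbors (token_graph k G) (insert u S) \<inter>
    neighbors (token_graph k G) (insert v S)" if w: "w \<in> ?N" for w
  proof (cases "w \<in> S")
    case True
    have "card (h w) = k" using True S finS card_Suc_Diff1[OF finS True] by (simp add: h_def)
    then have "h w \<in> k_subsets k (vertices G)"
      using True S by (auto simp: h_def k_subsets_def)
    moreover have "sym_diff (insert u S) (h w) = {v, w}" "sym_diff (insert v S) (h w) = {u, w}"
      using True S N[OF w] by (auto simp: h_def)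
    ultimately show ?thesis using N[OF w] mem by (simp add: neighbors_token_graph)
  next
    case False
    have "h w \<in> k_subsets k (vertices G)"
      using False S N[OF w] fin by (simp add: h_def insert_in_k_subsets)
    moreover have "sym_diff (insert u S) (h w) = {u, w}" "sym_diff (insert v S) (h w) = {v, w}"
      using False S N[OF w] by (auto simp: h_def)
    ultimately show ?thesis using N[OF w] mem by (simp add: neighbors_token_graph)
  qed
  ultimately show ?thesis
    using fin finite_k_subsets[OF fin, of k] mem
    by (intro card_inj_on_le[of h]) (auto simp: neighbors_token_graph)
qed

text \<open>
  At Johnson distance two, a common neighbour arises from \<open>A\<close> by exchanging an element of
  \<open>A - B\<close> for one of \<open>B - A\<close>, so there are at most four of them.
\<close>
lemma many_common_neighbors_imp_johnson_adjacent:
  assumes G: "fin_simple_graph G"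
    and AB: "A \<in> k_subsets k (vertices G)" "B \<in> k_subsets k (vertices G)" "A \<noteq> B"
    and five: "card (neighbors (token_graph k G) A \<inter> neighbors (token_graph k G) B) \<ge> 5"
  shows "card (sym_diff A B) = 2"
proof (rule ccontr)
  assume not2: "card (sym_diff A B) \<noteq> 2"
  let ?N = "neighbors (token_graph k G) A \<inter> neighbors (token_graph k G) B"
  have fin: "finite (vertices G)" and e2: "\<And>e. e \<in> edges G \<Longrightarrow> card e = 2"
    using G by (auto simp: fin_simple_graph_def)
  have C: "C \<in> k_subsets k (vertices G)" "card (sym_diff A C) = 2" "card (sym_diff B C) = 2"
    if "C \<in> ?N" for C
    using that AB e2 by (auto simp: neighbors_token_graph)
  have disj: "sym_diff A C \<inter> sym_diff B C = {}" if "C \<in> ?N" for C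
  proof (rule disjoint_if_card_sym_diff)
    have "sym_diff (sym_diff A C) (sym_diff B C) = sym_diff A B" by blast
    then show "card (sym_diff (sym_diff A C) (sym_diff B C)) \<noteq> 2"
      "sym_diff A C \<noteq> sym_diff B C" using not2 AB(3) by auto
  qed (use C that in auto)
  have sub: "?N \<subseteq> (\<lambda>(a, b). insert b (A - {a})) ` ((A - B) \<times> (B - A))"
  proof
    fix C assume CN: "C \<in> ?N"
    obtain S a b where S: "A = insert a S" "C = insert b S" "a \<notin> S" "b \<notin> S" "a \<noteq> b"
      using k_subsets_sym_diff_eq_2E[OF fin AB(1) C(1,2)[OF CN]] by metis
    \<comment> \<open>Exactly one of \<open>A\<close> and \<open>C\<close> contains
      \<open>a\<close>, and likewise \<open>b\<close>; disjointness of the labels makes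
      \<open>B\<close> agree with \<open>C\<close> on both, so \<open>a\<close> leaves for good and
      \<open>b\<close> already belongs to \<open>B\<close>.\<close>
    then have "a \<notin> sym_diff B C" "b \<notin> sym_diff B C" using disj[OF CN] by auto
    then have "(a, b) \<in> (A - B) \<times> (B - A)" "C = insert b (A - {a})" using S by auto
    then show "C \<in> (\<lambda>(a, b). insert b (A - {a})) ` ((A - B) \<times> (B - A))"
      by (intro image_eqI[of _ _ "(a, b)"]) auto
  qed
  have finAB: "finite A" "finite B" using AB fin finite_member_k_subsets by blast+
  have "?N \<noteq> {}" using five by force
  then obtain C where CN: "C \<in> ?N" by blast
  obtain S a b where S: "A = insert a S" "C = insert b S"
    using k_subsets_sym_diff_eq_2E[OF fin AB(1) C(1,2)[OF CN]] by metis
  obtain S' a' b' where S': "B = insert a' S'" "C = insert b' S'"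
    using k_subsets_sym_diff_eq_2E[OF fin AB(2) C(1,3)[OF CN]] by metis
  have le2: "card {x, y} \<le> 2" for x y :: 'a by (simp add: card_insert_if)
  \<comment> \<open>A single common neighbour bounds both differences: \<open>A - B\<close> lies in
    the union of \<open>A - C\<close> and \<open>C - B\<close>, each with at most one element, and
    similarly for \<open>B - A\<close>.\<close>
  have "A - B \<subseteq> {a, b'}" "B - A \<subseteq> {a', b}" using S S' by auto
  then have "card (A - B) \<le> 2" "card (B - A) \<le> 2"
    using le2 by (meson card_mono finite.intros le_trans)+
  then have "card (A - B) * card (B - A) \<le> 2 * 2" by (rule mult_le_mono)
  moreover have "card ?N \<le> card ((\<lambda>(a, b). insert b (A - {a})) ` ((A - B) \<times> (B - A)))"
    using finAB by (intro card_mono[OF _ sub]) auto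
  moreover have "\<dots> \<le> card ((A - B) \<times> (B - A))" using finAB by (intro card_image_le) auto
  ultimately show False using five by (simp add: card_cartesian_product)
qed

section \<open>Counting and invariance under isomorphism\<close>

text \<open>By Pascal's rule each step from \<open>c\<close> to \<open>Suc c\<close> with
  \<open>k \<le> c\<close> adds the positive term \<open>c choose (k - 1)\<close>, so the binomial
  is strictly increasing there.\<close>

lemma card_eq_if_choose_eq:
  fixes m n k :: nat
  assumes "n choose k = m choose k" "1 \<le> k" "k < n" "k < m"
  shows "n = m"
proof -
  have mono: "a choose k < b choose k" if "a < b" "k \<le> a" for a b
    using that
  proof (induction b rule: less_induct)
    case (less b)
    obtain c where c: "b = Suc c" using less.prems by (cases b) auto
    obtain j where j: "k = Suc j" using assms(2) by (cases k) auto
    have "c choose k < b choose k" using c j less.prems by simp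
    moreover have "a choose k \<le> c choose k"
      using less c by (cases "a = c") (auto simp: less_imp_le)
    ultimately show ?case by simp
  qed
  show ?thesis using mono[of n m] mono[of m n] assms by (metis less_irrefl less_imp_le nat_neq_iff)
qed

text \<open>Used to upgrade one-way preservation of Johnson adjacency to an equivalence: an
  injection between finite sets of equal size is onto.\<close>

lemma card_johnson_adjacent_pairs_eq:
  assumes "finite V" "finite W" "card V = card W"
  shows "card {(A, B). A \<in> k_subsets k V \<and> B \<in> k_subsets k V \<and> card (sym_diff A B) = 2} =
    card {(A, B). A \<in> k_subsets k W \<and> B \<in> k_subsets k W \<and> card (sym_diff A B) = 2}"
proof -
  \<comment> \<open>Proved for arbitrary point types, so that it can be used in both
    directions.\<close>
  have le: "card {(A, B). A \<in> k_subsets k X \<and> B \<in> k_subsets k X \<and> card (sym_diff A B) = 2} \<le>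
    card {(A, B). A \<in> k_subsets k Y \<and> B \<in> k_subsets k Y \<and> card (sym_diff A B) = 2}"
    (is "card ?P \<le> card ?Q")
    if XY: "finite X" "finite Y" "card X = card Y" for X :: "'c set" and Y :: "'d set"
  proof -
    obtain h where h: "bij_betw h X Y" using finite_same_card_bij[OF XY] by blast
    have inj: "inj_on h X" and im: "h ` X = Y" using h by (auto simp: bij_betw_def)
    have mem: "h ` A \<in> k_subsets k Y" if "A \<in> k_subsets k X" for A
      using that inj im by (auto simp: k_subsets_def card_image inj_on_subset)
    have sd: "card (sym_diff (h ` A) (h ` B)) = card (sym_diff A B)"
      if "A \<in> k_subsets k X" "B \<in> k_subsets k X" for A B
    proof -
      have sub: "A \<subseteq> X" "B \<subseteq> X" using that by (auto simp: k_subsets_def)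
      have "sym_diff (h ` A) (h ` B) = h ` sym_diff A B"
        using sub inj by (auto dest: inj_onD)
      also have "card \<dots> = card (sym_diff A B)"
        using sub inj by (intro card_image) (auto intro: inj_on_subset)
      finally show ?thesis .
    qed
    have "finite ?Q"
      by (rule finite_subset[of _ "k_subsets k Y \<times> k_subsets k Y"])
        (use finite_k_subsets[OF XY(2)] in auto)
    moreover have "inj_on (map_prod ((`) h) ((`) h)) ?P"
    proof (rule inj_on_subset)
      show "inj_on (map_prod ((`) h) ((`) h)) (Pow X \<times> Pow X)"
        using inj by (intro map_prod_inj_on inj_on_image_Pow)
      show "?P \<subseteq> Pow X \<times> Pow X" by (auto simp: k_subsets_def)
    qed
    moreover have "map_prod ((`) h) ((`) h) ` ?P \<subseteq> ?Q" using mem sd by auto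
    ultimately show ?thesis by (intro card_inj_on_le)
  qed
  show ?thesis using le[of V W] le[of W V] assms by (intro order.antisym) auto
qed

lemma card_common_neighbors_graph_iso:
  assumes f: "bij_betw f (vertices G) (vertices H)"
    and e: "\<And>u v. u \<in> vertices G \<Longrightarrow> v \<in> vertices G \<Longrightarrow>
      {u, v} \<in> edges G \<longleftrightarrow> {f u, f v} \<in> edges H"
    and u: "u \<in> vertices G" and v: "v \<in> vertices G"
  shows "card (neighbors H (f u) \<inter> neighbors H (f v)) = card (neighbors G u \<inter> neighbors G v)"
proof -
  have "neighbors H (f u) \<inter> neighbors H (f v) = f ` (neighbors G u \<inter> neighbors G v)"
  proof (intro equalityI subsetI)
    fix x assume x: "x \<in> neighbors H (f u) \<inter> neighbors H (f v)"
    then obtain w where "w \<in> vertices G" "x = f w"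
      using f by (auto simp: neighbors_def bij_betw_def)
    then show "x \<in> f ` (neighbors G u \<inter> neighbors G v)"
      using x e u v by (auto simp: neighbors_def)
  qed (use f e u v in \<open>auto simp: neighbors_def bij_betw_def\<close>)
  moreover have "inj_on f (neighbors G u \<inter> neighbors G v)"
    using f by (auto simp: bij_betw_def neighbors_def intro: inj_on_subset)
  ultimately show ?thesis by (simp add: card_image)
qed

section \<open>Reconstructing the base graph from its token graph\<close>

theorem theorem2:
  fixes G :: "'a graph" and H :: "'b graph" and n k :: nat
  assumes "fin_simple_graph G"
    and "card (vertices G) = n"
    and "admissible_augmentation G = complete_graph (vertices G)"
    and "1 \<le> k" and "k < n"
    and "fin_simple_graph H"
    and "k < card (vertices H)"
    and "graph_iso (token_graph k G) (token_graph k H)"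
  shows "graph_iso G H"
proof -
  let ?V = "vertices G" and ?W = "vertices H"
  let ?K = "k_subsets k ?V" and ?L = "k_subsets k ?W"
  have finV: "finite ?V" and finW: "finite ?W"
    using assms(1,6) by (auto simp: fin_simple_graph_def)
  have nonadj: "card (neighbors G u \<inter> neighbors G v) \<ge> 5"
    if "u \<in> ?V" "v \<in> ?V" "u \<noteq> v" "{u, v} \<notin> edges G" for u v
    using assms(3) that admissible_augmentation_eq_complete_graph_iff[OF assms(1)] by blast
  obtain \<phi> where bij: "bij_betw \<phi> ?K ?L" and
    edge: "\<And>A B. A \<in> ?K \<Longrightarrow> B \<in> ?K \<Longrightarrow>
      {A, B} \<in> edges (token_graph k G) \<longleftrightarrow> {\<phi> A, \<phi> B} \<in> edges (token_graph k H)"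
    using assms(8) unfolding graph_iso_def vertices_token_graph by blast
  have mem: "\<phi> A \<in> ?L" if "A \<in> ?K" for A using bij that by (auto dest: bij_betwE)
  have inj: "inj_on \<phi> ?K" using bij by (simp add: bij_betw_def)
  have sd_edge: "sym_diff A B \<in> edges G \<longleftrightarrow> sym_diff (\<phi> A) (\<phi> B) \<in> edges H"
    if "A \<in> ?K" "B \<in> ?K" for A B
    using edge that mem by (simp add: edges_token_graph_iff)
  have "card ?K = card ?L" using bij by (rule bij_betw_same_card)
  then have "n choose k = card ?W choose k"
    using finV finW assms(2) by (simp add: k_subsets_def n_subsets)
  then have n: "n = card ?W" using assms(4,5,7) by (rule card_eq_if_choose_eq)
  \<comment> \<open>Only this direction is direct: the augmentation hypothesis concerns
    \<open>G\<close>, and nothing similar is known for \<open>H\<close>.\<close>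
  have johnson: "card (sym_diff (\<phi> A) (\<phi> B)) = 2"
    if AB: "A \<in> ?K" "B \<in> ?K" "card (sym_diff A B) = 2" for A B
  proof (cases "sym_diff A B \<in> edges G")
    case True
    then show ?thesis using sd_edge AB assms(6) by (auto simp: fin_simple_graph_def)
  next
    case False
    obtain S u v where S: "A = insert u S" "B = insert v S" "u \<notin> S" "v \<notin> S" "u \<noteq> v"
      "S \<subseteq> ?V" "u \<in> ?V" "v \<in> ?V" "sym_diff A B = {u, v}" "k = Suc (card S)"
      using k_subsets_sym_diff_eq_2E[OF finV AB] by blast
    have "5 \<le> card (neighbors G u \<inter> neighbors G v)" using nonadj S False by simp
    also have "\<dots> \<le> card (neighbors (token_graph k G) A \<inter> neighbors (token_graph k G) B)"
      using card_common_neighbors_token_graph_ge[OF assms(1)] S by blast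
    also have "\<dots> = card (neighbors (token_graph k H) (\<phi> A) \<inter> neighbors (token_graph k H) (\<phi> B))"
      by (rule card_common_neighbors_graph_iso[symmetric])
        (use bij edge AB in \<open>simp_all add: vertices_token_graph\<close>)
    finally have "5 \<le> card (neighbors (token_graph k H) (\<phi> A) \<inter>
      neighbors (token_graph k H) (\<phi> B))" .
    moreover have "\<phi> A \<noteq> \<phi> B" using inj AB by (auto simp: inj_on_eq_iff)
    ultimately show ?thesis
      using many_common_neighbors_imp_johnson_adjacent[OF assms(6)] mem AB by blast
  qed
  let ?P = "{(A, B). A \<in> ?K \<and> B \<in> ?K \<and> card (sym_diff A B) = 2}"
  let ?Q = "{(A, B). A \<in> ?L \<and> B \<in> ?L \<and> card (sym_diff A B) = 2}"
  have inj2: "inj_on (map_prod \<phi> \<phi>) (?K \<times> ?K)" using inj by (intro map_prod_inj_on)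
  have "finite ?Q"
    by (rule finite_subset[of _ "?L \<times> ?L"]) (use finite_k_subsets[OF finW] in auto)
  moreover have "map_prod \<phi> \<phi> ` ?P \<subseteq> ?Q" using johnson mem by auto
  moreover have "card (map_prod \<phi> \<phi> ` ?P) = card ?Q"
  proof -
    have "inj_on (map_prod \<phi> \<phi>) ?P" by (rule inj_on_subset[OF inj2]) auto
    then show ?thesis
      using card_johnson_adjacent_pairs_eq[OF finV finW] n assms(2) by (simp add: card_image)
  qed
  \<comment> \<open>Every Johnson-adjacent pair over \<open>H\<close> is now the image of one over
    \<open>G\<close>, which supplies the converse direction.\<close>
  ultimately have onto: "map_prod \<phi> \<phi> ` ?P = ?Q" by (rule card_subset_eq)
  interpret johnson_iso ?V ?W k \<phi>
  proof
    fix A B assume AB: "A \<in> ?K" "B \<in> ?K"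
    show "card (sym_diff (\<phi> A) (\<phi> B)) = 2 \<longleftrightarrow> card (sym_diff A B) = 2"
    proof
      assume "card (sym_diff (\<phi> A) (\<phi> B)) = 2"
      then have "(\<phi> A, \<phi> B) \<in> map_prod \<phi> \<phi> ` ?P" using onto AB mem by simp
      then obtain A' B' where "(A', B') \<in> ?P" "\<phi> A = \<phi> A'" "\<phi> B = \<phi> B'" by auto
      then show "card (sym_diff A B) = 2" using AB by (auto simp: inj_on_eq_iff[OF inj])
    qed (use johnson AB in blast)
  qed (use finV finW bij in auto)
  obtain f where f: "bij_betw f ?V ?W"
    "\<And>A B u v. A \<in> ?K \<Longrightarrow> B \<in> ?K \<Longrightarrow> u \<noteq> v \<Longrightarrow>
      sym_diff A B = {u, v} \<Longrightarrow> sym_diff (\<phi> A) (\<phi> B) = {f u, f v}"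
    using point_map assms n by metis
  have "{u, v} \<in> edges G \<longleftrightarrow> {f u, f v} \<in> edges H" if uv: "u \<in> ?V" "v \<in> ?V" for u v
  proof (cases "u = v")
    case True
    then have "{u, v} \<notin> edges G" "{f u, f v} \<notin> edges H"
      using assms(1,6) by (auto simp: fin_simple_graph_def)
    then show ?thesis by simp
  next
    case False
    \<comment> \<open>Whether two tokens with label \<open>{u, v}\<close> are adjacent decides
      whether \<open>{u, v}\<close> is an edge, and their images carry the label
      \<open>{f u, f v}\<close>.\<close>
    obtain A B where AB: "A \<in> ?K" "B \<in> ?K" "sym_diff A B = {u, v}"
      using k_subsets_pair_realised[OF finV uv False] assms by metis
    then show ?thesis using f(2)[OF AB(1,2) False AB(3)] sd_edge[OF AB(1,2)] by simp
  qed
  then show ?thesis using f(1) unfolding graph_iso_def by blast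
qed

end
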